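(* Let $W=\{W(t):t\in[a,b]\}$ be a Brownian motion and let $L$ be the weak random operator $\langle Lf,h\rangle:=\varepsilon(f,h)=-\int_a^b f'(t)h'(t)\,dt+\int_a^b f(t)h'(t)W(t)\,dt$. Two linearly independent solutions of the problem $Lf=0$ are $$u(t):=\frac{e^{\int_a^t W(s)\,ds}\int_a^t e^{-\int_a^s W(r)\,dr}\,ds}{e^{\int_a^b W(s)\,ds}\int_a^b e^{-\int_a^s W(r)\,dr}\,ds},\qquad v(t):=\frac{e^{\int_a^t W(s)\,ds}\int_t^b e^{-\int_a^s W(r)\,dr}\,ds}{\int_a^b e^{-\int_a^s W(r)\,dr}\,ds},\qquad t\in[a,b].$$ Furthermore, they satisfy $u(a)=0$, $u(b)=1$, $v(a)=1$ and $v(b)=0$.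
   Context: Fix real numbers $a<b$ and a Brownian motion $W=\{W(t):t\in[a,b]\}$ with continuous paths. Let $H_1$ be the Sobolev space of absolutely continuous functions $h:[a,b]\to\mathbb{R}$ with $h,h'\in L_2[a,b]$ and $h(a)=h(b)=0$. The operator $L$ is formally $(Lf)(t)=f''(t)-W(t)f'(t)-W'(t)f(t)$; it is given rigorous meaning only through the bilinear form $$\langle Lf,h\rangle:=\varepsilon(f,h):=-\int_a^b f'(t)h'(t)\,dt+\int_a^b f(t)h'(t)W(t)\,dt .$$ The form is defined for $f,h\in H_1$, and the same formula is used for $h\in H_1$ and for $f$ absolutely continuous with $f'\in L_2[a,b]$, without boundary conditions on $f$. A stochastic process $\{u(t):t\in[a,b]\}$ (with paths regular enough for the formula to make sense) is called a solution of $Lf=0$ if for all $h\in H_1$, $\varepsilon(u,h)=0$ almost surely. *)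

theory Defs
  imports "HOL-Probability.Probability"
begin

text \<open>
  A process indexed by \<open>[a, b]\<close> is a function \<open>W :: real \<Rightarrow> 'a \<Rightarrow> real\<close> (time first, then sample point);
  its values at times outside \<open>[a, b]\<close> are irrelevant.
  No law is prescribed for the starting value \<open>W a\<close>, so the definition covers \<open>W a = 0\<close> as well as
  the restriction to \<open>[a, b]\<close> of a (one- or two-sided) Brownian motion that vanishes at time \<open>0\<close>.
  The second argument of \<^const>\<open>normal_density\<close> is the standard deviation.
\<close>

definition brownian_motion_on :: "'a measure \<Rightarrow> real \<Rightarrow> real \<Rightarrow> (real \<Rightarrow> 'a \<Rightarrow> real) \<Rightarrow> bool" where
  "brownian_motion_on M a b W \<longleftrightarrow>
     prob_space M \<and>
     (\<forall>t\<in>{a..b}. W t \<in> borel_measurable M) \<and>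
     (\<forall>s t. a \<le> s \<longrightarrow> s < t \<longrightarrow> t \<le> b \<longrightarrow>
        distributed M lborel (\<lambda>\<omega>. W t \<omega> - W s \<omega>) (normal_density 0 (sqrt (t - s)))) \<and>
     (\<forall>n (\<tau> :: nat \<Rightarrow> real). (\<forall>i\<le>n. \<tau> i \<in> {a..b}) \<longrightarrow> (\<forall>i<n. \<tau> i < \<tau> (Suc i)) \<longrightarrow>
        prob_space.indep_vars M (\<lambda>_. borel) (\<lambda>i \<omega>. W (\<tau> (Suc i)) \<omega> - W (\<tau> i) \<omega>) {..<n}) \<and>
     (\<forall>\<omega>\<in>space M. continuous_on {a..b} (\<lambda>t. W t \<omega>))"

text \<open>
  Absolute continuity in the \<open>\<epsilon>\<close>-\<open>\<delta>\<close> sense. The members of a division are compact intervals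
  \<open>[Inf k, Sup k]\<close> with pairwise disjoint interiors.
\<close>

definition absolutely_continuous_fun_on :: "real \<Rightarrow> real \<Rightarrow> (real \<Rightarrow> real) \<Rightarrow> bool" where
  "absolutely_continuous_fun_on a b f \<longleftrightarrow>
     (\<forall>e>0. \<exists>d>0. \<forall>D. D division_of \<Union>D \<longrightarrow> \<Union>D \<subseteq> {a..b} \<longrightarrow>
        (\<Sum>k\<in>D. Sup k - Inf k) < d \<longrightarrow> (\<Sum>k\<in>D. \<bar>f (Sup k) - f (Inf k)\<bar>) < e)"

definition L2_on :: "real \<Rightarrow> real \<Rightarrow> (real \<Rightarrow> real) \<Rightarrow> bool" where
  "L2_on a b f \<longleftrightarrow>
     set_borel_measurable lebesgue {a..b} f \<and> set_integrable lebesgue {a..b} (\<lambda>t. (f t)\<^sup>2)"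

text \<open>
  \<open>f\<close> is absolutely continuous and \<open>f' \<in> L\<^sub>2[a, b]\<close>. Since \<^const>\<open>deriv\<close> is total, the existence
  of \<open>f'\<close> almost everywhere is spelled out; by Lebesgue's theorem this excludes no absolutely
  continuous function. The two endpoints, where \<^term>\<open>deriv f\<close> sees \<open>f\<close> outside \<open>[a, b]\<close>,
  form a null set.
\<close>

definition AC2_on :: "real \<Rightarrow> real \<Rightarrow> (real \<Rightarrow> real) \<Rightarrow> bool" where
  "AC2_on a b f \<longleftrightarrow>
     absolutely_continuous_fun_on a b f \<and>
     (AE t in lebesgue. t \<in> {a<..<b} \<longrightarrow> f field_differentiable (at t)) \<and>
     L2_on a b (deriv f)"

definition H1 :: "real \<Rightarrow> real \<Rightarrow> (real \<Rightarrow> real) set" where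
  "H1 a b = {h. AC2_on a b h \<and> L2_on a b h \<and> h a = 0 \<and> h b = 0}"

text \<open>The form along one path \<open>w\<close> of the process \<open>W\<close>.\<close>

definition form_eps :: "real \<Rightarrow> real \<Rightarrow> (real \<Rightarrow> real) \<Rightarrow> (real \<Rightarrow> real) \<Rightarrow> (real \<Rightarrow> real) \<Rightarrow> real" where
  "form_eps a b w f h =
     - (LINT t:{a..b}|lebesgue. deriv f t * deriv h t)
     + (LINT t:{a..b}|lebesgue. f t * deriv h t * w t)"

text \<open>The exceptional null set may depend on the test function \<open>h\<close>.\<close>

definition solution_L ::
  "'a measure \<Rightarrow> real \<Rightarrow> real \<Rightarrow> (real \<Rightarrow> 'a \<Rightarrow> real) \<Rightarrow> (real \<Rightarrow> 'a \<Rightarrow> real) \<Rightarrow> bool" where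
  "solution_L M a b W u \<longleftrightarrow>
     (\<forall>t\<in>{a..b}. u t \<in> borel_measurable M) \<and>
     (\<forall>\<omega>\<in>space M. AC2_on a b (\<lambda>t. u t \<omega>)) \<and>
     (\<forall>h\<in>H1 a b. AE \<omega> in M. form_eps a b (\<lambda>t. W t \<omega>) (\<lambda>t. u t \<omega>) h = 0)"

definition lin_indep_on :: "real set \<Rightarrow> (real \<Rightarrow> real) \<Rightarrow> (real \<Rightarrow> real) \<Rightarrow> bool" where
  "lin_indep_on A f g \<longleftrightarrow> (\<forall>c d. (\<forall>t\<in>A. c * f t + d * g t = 0) \<longrightarrow> c = 0 \<and> d = 0)"

definition sol_u :: "real \<Rightarrow> real \<Rightarrow> (real \<Rightarrow> 'a \<Rightarrow> real) \<Rightarrow> real \<Rightarrow> 'a \<Rightarrow> real" where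
  "sol_u a b W t \<omega> =
     (exp (LBINT s:{a..t}. W s \<omega>) * (LBINT s:{a..t}. exp (- (LBINT r:{a..s}. W r \<omega>)))) /
     (exp (LBINT s:{a..b}. W s \<omega>) * (LBINT s:{a..b}. exp (- (LBINT r:{a..s}. W r \<omega>))))"

definition sol_v :: "real \<Rightarrow> real \<Rightarrow> (real \<Rightarrow> 'a \<Rightarrow> real) \<Rightarrow> real \<Rightarrow> 'a \<Rightarrow> real" where
  "sol_v a b W t \<omega> =
     (exp (LBINT s:{a..t}. W s \<omega>) * (LBINT s:{t..b}. exp (- (LBINT r:{a..s}. W r \<omega>)))) /
     (LBINT s:{a..b}. exp (- (LBINT r:{a..s}. W r \<omega>)))"

end

theory Submission
  imports Defs
begin

text \<open>
  Both candidates satisfy pathwise a first-order equation \<open>f' = W f + k\<close> with a constant \<open>k\<close>.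
  The integrand of the form is then almost everywhere \<open>- k h'\<close>, and \<open>\<integral> h' = h b - h a = 0\<close>
  by the fundamental theorem of calculus for absolutely continuous functions.
\<close>

subsection \<open>Absolutely continuous functions\<close>

text \<open>The Riemann sums of \<open>f'\<close> are compared with the telescoping sum of the
  increments of \<open>f\<close>. Intervals tagged where \<open>f\<close> is differentiable have
  small error by linear approximation. Those tagged in the exceptional null set lie in an open set
  of small measure, so absolute continuity bounds their increments.\<close>

theorem fundamental_theorem_of_calculus_absolutely_continuous:
  fixes f f' :: "real \<Rightarrow> real"
  assumes "a \<le> b"
    and ac: "absolutely_continuous_fun_on a b f"
    and deriv: "AE t in lebesgue. t \<in> {a<..<b} \<longrightarrow> (f has_real_derivative f' t) (at t)"
  shows "(f' has_integral (f b - f a)) {a..b}"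
proof -
  \<comment> \<open>The endpoints join the exceptional set, since differentiability is only given in
    the open interval.\<close>
  define N where "N = {a, b} \<union> {t. \<not> (t \<in> {a<..<b} \<longrightarrow> (f has_real_derivative f' t) (at t))}"
  have N: "negligible N"
    using deriv unfolding N_def
    by (intro negligible_Un) (auto simp: eventually_ae_filter negligible_iff_null_sets intro: null_sets_completion_subset)
  have N_deriv: "(f has_real_derivative f' t) (at t)" if "t \<in> {a..b}" "t \<notin> N" for t
    using that by (auto simp: N_def)
  \<comment> \<open>With value 0 on \<open>N\<close>, tags in \<open>N\<close> add nothing to a
    Riemann sum; the integral does not see the change on a null set.\<close>
  define g where "g = (\<lambda>t. if t \<in> N then 0 else f' t)"
  have "(g has_integral (f b - f a)) {a..b}"
    unfolding has_integral_real
  proof (intro allI impI)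
    fix e :: real
    assume "e > 0"
    \<comment> \<open>Chosen so that \<open>e1 * (b - a)\<close> is at most \<open>e / 2\<close>;
      the summand 1 keeps the denominator positive when \<open>a = b\<close>.\<close>
    define e1 where "e1 = e / (2 * (b - a + 1))"
    have "e1 > 0" using \<open>e > 0\<close> \<open>a \<le> b\<close> by (simp add: e1_def)
    obtain \<delta> where "\<delta> > 0" and \<delta>: "\<And>D. \<lbrakk>D division_of \<Union>D; \<Union>D \<subseteq> {a..b}; (\<Sum>k\<in>D. Sup k - Inf k) < \<delta>\<rbrakk>
        \<Longrightarrow> (\<Sum>k\<in>D. \<bar>f (Sup k) - f (Inf k)\<bar>) < e / 2"
      using ac \<open>e > 0\<close> unfolding absolutely_continuous_fun_on_def by (meson half_gt_zero)
    obtain U where "open U" "N \<subseteq> U"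
      and U_N: "U - N \<in> lmeasurable" "emeasure lebesgue (U - N) < ennreal \<delta>"
      using sets_lebesgue_outer_open[OF negligible_imp_sets[OF N] \<open>\<delta> > 0\<close>] by blast
    have U: "U \<in> lmeasurable"
      using U_N(1) N \<open>N \<subseteq> U\<close> negligible_imp_measurable fmeasurable.Un by (metis Diff_partition sup_commute)
    have "measure lebesgue U = measure lebesgue (U - N)"
      using N U by (simp add: measure_Diff_null_set negligible_iff_null_sets)
    also have "\<dots> < \<delta>"
      using U_N \<open>\<delta> > 0\<close> by (simp add: emeasure_eq_measure2 ennreal_less_iff)
    finally have U_less: "measure lebesgue U < \<delta>" .
    \<comment> \<open>The radius of the gauge at \<open>t\<close>: off \<open>N\<close> it enforces
      the linear approximation of \<open>f\<close> up to slope \<open>e1\<close>, on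
      \<open>N\<close> it keeps the ball inside \<open>U\<close>.\<close>
    have "\<exists>d>0. (t \<in> {a..b} - N \<longrightarrow> (\<forall>y. \<bar>y - t\<bar> < d \<longrightarrow> \<bar>f y - f t - f' t * (y - t)\<bar> \<le> e1 * \<bar>y - t\<bar>))
        \<and> (t \<in> N \<longrightarrow> ball t d \<subseteq> U)" for t
    proof (cases "t \<in> N")
      case True
      then show ?thesis using \<open>open U\<close> \<open>N \<subseteq> U\<close> by (auto simp: open_contains_ball)
    next
      case False
      show ?thesis
      proof (cases "t \<in> {a..b}")
        case True
        then have "(f has_derivative (\<lambda>y. f' t * y)) (at t)"
          using N_deriv False by (simp add: has_field_derivative_def)
        then show ?thesis
          using False \<open>e1 > 0\<close> unfolding has_derivative_at_alt real_norm_def by blast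
      qed (use False zero_less_one in blast)
    qed
    then obtain d where d: "\<And>t. d t > 0"
      and d_deriv: "\<And>t y. \<lbrakk>t \<in> {a..b} - N; \<bar>y - t\<bar> < d t\<rbrakk> \<Longrightarrow> \<bar>f y - f t - f' t * (y - t)\<bar> \<le> e1 * \<bar>y - t\<bar>"
      and d_N: "\<And>t. t \<in> N \<Longrightarrow> ball t (d t) \<subseteq> U"
      by metis
    show "\<exists>\<gamma>. gauge \<gamma> \<and> (\<forall>p. p tagged_division_of {a..b} \<and> \<gamma> fine p \<longrightarrow>
        norm ((\<Sum>(x, k)\<in>p. measure lborel k *\<^sub>R g x) - (f b - f a)) < e)"
    proof (intro exI conjI allI impI)
      show "gauge (\<lambda>t. ball t (d t))"
        using d gauge_ball_dependent by blast
      fix p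
      assume asm: "p tagged_division_of {a..b} \<and> (\<lambda>t. ball t (d t)) fine p"
      then have p: "p tagged_division_of {a..b}" and fine: "\<And>x k. (x, k) \<in> p \<Longrightarrow> k \<subseteq> ball x (d x)"
        by (auto simp: fine_def)
      have interval: "\<exists>u v. k = {u..v} \<and> u \<le> x \<and> x \<le> v \<and> a \<le> u \<and> v \<le> b" if "(x, k) \<in> p" for x k
      proof -
        obtain u v where "k = cbox u v" using tagged_division_ofD(4)[OF p \<open>(x, k) \<in> p\<close>] by blast
        moreover have "x \<in> k" "k \<subseteq> {a..b}" using tagged_division_ofD(2,3)[OF p \<open>(x, k) \<in> p\<close>] by blast+
        ultimately show ?thesis by auto
      qed
      have fin: "finite p" by (rule tagged_division_ofD(1)[OF p])
      define q where "q = {(x, k) \<in> p. x \<in> N}"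
      have q: "q \<subseteq> p" "finite q" using fin by (auto simp: q_def intro: rev_finite_subset)
      have part: "q tagged_partial_division_of {a..b}"
        using p q(1) unfolding tagged_division_of_def by (blast intro: tagged_partial_division_subset)
      define D where "D = snd ` q"
      have D: "D division_of \<Union>D"
        unfolding D_def by (rule partial_division_of_tagged_division[OF part])
      have D_ne: "k \<noteq> {}" if "k \<in> D" for k using division_ofD(3)[OF D that] .
      have DU: "\<Union>D \<subseteq> U" using fine d_N unfolding D_def q_def by fastforce
      have Dab: "\<Union>D \<subseteq> {a..b}"
        using interval q(1) unfolding D_def by fastforce
      have "(\<Sum>k\<in>D. Sup k - Inf k) = (\<Sum>k\<in>D. measure lebesgue k)"
      proof (rule sum.cong)
        fix k assume "k \<in> D"
        then obtain x where "(x, k) \<in> p" using q(1) by (auto simp: D_def)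
        from interval[OF this] show "Sup k - Inf k = measure lebesgue k" by auto
      qed simp
      also have "\<dots> = measure lebesgue (\<Union>D)" by (rule content_division[OF D])
      also have "\<dots> \<le> measure lebesgue U"
        using DU U lmeasurable_division[OF D] by (intro measure_mono_fmeasurable) auto
      finally have "(\<Sum>k\<in>D. Sup k - Inf k) < \<delta>" using U_less by simp
      then have small: "(\<Sum>k\<in>D. \<bar>f (Sup k) - f (Inf k)\<bar>) < e / 2" by (rule \<delta>[OF D Dab])
      \<comment> \<open>Passing from tagged pairs to bare intervals requires a function that
        vanishes on intervals without interior. The empty interval needs the explicit value 0, as
        its \<open>Sup\<close> and \<open>Inf\<close> carry no information.\<close>
      define \<phi> where "\<phi> = (\<lambda>k. if k = {} then 0 else \<bar>f (Sup k) - f (Inf k)\<bar>)"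
      have "(\<Sum>(x, k)\<in>q. \<phi> k) = (\<Sum>k\<in>D. \<phi> k)"
        unfolding D_def
        by (rule sum.over_tagged_division_lemma[OF tagged_partial_division_of_Union_self[OF part]])
          (auto simp: \<phi>_def)
      also have "\<dots> < e / 2" using small D_ne by (simp add: \<phi>_def cong: sum.cong)
      finally have sum_q: "(\<Sum>(x, k)\<in>q. \<phi> k) < e / 2" .
      have length: "(\<Sum>(x, k)\<in>p. Sup k - Inf k) = b - a"
        using additive_tagged_division_1[OF \<open>a \<le> b\<close> p, of "\<lambda>x. x"] .
      have "norm ((\<Sum>(x, k)\<in>p. measure lborel k *\<^sub>R g x) - (f b - f a))
          = norm (\<Sum>(x, k)\<in>p. measure lborel k *\<^sub>R g x - (f (Sup k) - f (Inf k)))"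
        using additive_tagged_division_1[OF \<open>a \<le> b\<close> p, of f] by (simp add: split_def sum_subtractf)
      also have "\<dots> \<le> (\<Sum>(x, k)\<in>p. e1 * (Sup k - Inf k) + (if (x, k) \<in> q then \<phi> k else 0))"
      proof (rule sum_norm_le, clarify)
        fix x k assume xk: "(x, k) \<in> p"
        obtain u v where k: "k = {u..v}" "u \<le> x" "x \<le> v" "a \<le> u" "v \<le> b"
          using interval[OF xk] by blast
        show "norm (measure lborel k *\<^sub>R g x - (f (Sup k) - f (Inf k)))
            \<le> e1 * (Sup k - Inf k) + (if (x, k) \<in> q then \<phi> k else 0)"
        \<comment> \<open>A tag in \<open>N\<close> leaves only the increment, which is
          \<open>\<phi> k\<close>. For any other tag, the estimates at the two ends \<open>u\<close>
          and \<open>v\<close> add up to \<open>e1 * (v - u)\<close> because \<open>x\<close> lies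
          between them.\<close>
        proof (cases "x \<in> N")
          case True
          then show ?thesis using xk k \<open>e1 > 0\<close> by (simp add: q_def \<phi>_def g_def abs_minus_commute)
        next
          case False
          have "u \<in> ball x (d x)" "v \<in> ball x (d x)" using subsetD[OF fine[OF xk]] k by auto
          then have "\<bar>f u - f x - f' x * (u - x)\<bar> \<le> e1 * \<bar>u - x\<bar>" "\<bar>f v - f x - f' x * (v - x)\<bar> \<le> e1 * \<bar>v - x\<bar>"
            using k False by (intro d_deriv; simp add: dist_real_def)+
          then have "\<bar>(v - u) * f' x - (f v - f u)\<bar> \<le> e1 * (v - u)"
            using k by (simp add: abs_if algebra_simps split: if_splits)
          then show ?thesis using k False by (simp add: q_def g_def)
        qed
      qed
      also have "\<dots> = e1 * (b - a) + (\<Sum>(x, k)\<in>p. if (x, k) \<in> q then \<phi> k else 0)"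
        by (simp add: split_def sum.distrib length[symmetric] sum_distrib_left)
      also have "(\<Sum>(x, k)\<in>p. if (x, k) \<in> q then \<phi> k else 0) = (\<Sum>(x, k)\<in>q. \<phi> k)"
        using q fin by (simp add: split_def sum.If_cases Int_absorb1 Int_commute)
      also have "e1 * (b - a) \<le> e / 2"
        using \<open>a \<le> b\<close> \<open>e > 0\<close> by (simp add: e1_def field_simps)
      finally show "norm ((\<Sum>(x, k)\<in>p. measure lborel k *\<^sub>R g x) - (f b - f a)) < e"
        using sum_q by simp
    qed
  qed
  then show ?thesis
    by (rule has_integral_spike[OF N, rotated]) (simp add: g_def)
qed

section \<open>Square-integrable derivatives and the form along one path\<close>

lemma L2_on_imp_set_integrable:
  assumes "L2_on a b f"
  shows "set_integrable lebesgue {a..b} f"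
proof (rule set_integrable_bound)
  show "set_integrable lebesgue {a..b} (\<lambda>t. 1 + (f t)\<^sup>2)"
    using assms unfolding L2_on_def by (intro set_integral_add) (auto simp: absolutely_integrable_continuous_real)
  show "set_borel_measurable lebesgue {a..b} f"
    using assms by (simp add: L2_on_def)
  \<comment> \<open>Expanding the square of \<open>\<bar>y\<bar> - 1/2\<close> gives even
    \<open>\<bar>y\<bar> \<le> 1/4 + y\<^sup>2\<close>; the constant is integrable because the
    interval is bounded.\<close>
  have "\<bar>y\<bar> \<le> 1 + y\<^sup>2" for y :: real
    using zero_le_power2[of "\<bar>y\<bar> - 1/2"] by (simp add: power2_eq_square algebra_simps)
  then show "AE t in lebesgue. t \<in> {a..b} \<longrightarrow> norm (f t) \<le> norm (1 + (f t)\<^sup>2)"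
    by simp
qed

text \<open>The boundary conditions on test functions enter here: the integral of
  \<open>deriv h\<close> is \<open>h b - h a\<close>.\<close>

lemma H1_deriv_has_integral_0:
  assumes "a \<le> b" "h \<in> H1 a b"
  shows "(deriv h has_integral 0) {a..b}"
proof -
  have "AE t in lebesgue. t \<in> {a<..<b} \<longrightarrow> (h has_real_derivative deriv h t) (at t)"
    using assms(2) by (auto simp: H1_def AC2_on_def DERIV_deriv_iff_field_differentiable)
  with assms show ?thesis
    using fundamental_theorem_of_calculus_absolutely_continuous[of a b h "deriv h"]
    by (auto simp: H1_def AC2_on_def)
qed

text \<open>Supplies the path regularity demanded of a solution. A continuous derivative is bounded
  on the compact interval, so \<open>f\<close> is Lipschitz and hence absolutely continuous.\<close>

lemma AC2_on_C1:
  assumes deriv: "\<And>t. t \<in> {a..b} \<Longrightarrow> (f has_real_derivative g t) (at t within {a..b})"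
    and cont: "continuous_on {a..b} g"
  shows "AC2_on a b f"
proof -
  obtain B where B: "\<And>t. t \<in> {a..b} \<Longrightarrow> \<bar>g t\<bar> \<le> B"
    using compact_imp_bounded[OF compact_continuous_image[OF cont compact_Icc]]
    unfolding bounded_iff by (metis imageI real_norm_def)
  \<comment> \<open>A strictly positive Lipschitz constant, so that \<open>e / C\<close> can serve
    as the threshold in the definition of absolute continuity.\<close>
  define C where "C = \<bar>B\<bar> + 1"
  have "C > 0" by (simp add: C_def)
  have lip: "\<bar>f y - f x\<bar> \<le> C * \<bar>y - x\<bar>" if "x \<in> {a..b}" "y \<in> {a..b}" for x y
  proof -
    have "norm (f y - f x) \<le> C * norm (y - x)"
      using deriv B that by (intro field_differentiable_bound[of "{a..b}" f g]) (force simp: C_def)+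
    then show ?thesis by simp
  qed
  have "absolutely_continuous_fun_on a b f"
    unfolding absolutely_continuous_fun_on_def
  proof (intro allI impI)
    fix e :: real assume "e > 0"
    have "(\<Sum>k\<in>D. \<bar>f (Sup k) - f (Inf k)\<bar>) < e"
      if D: "D division_of \<Union>D" "\<Union>D \<subseteq> {a..b}" and less: "(\<Sum>k\<in>D. Sup k - Inf k) < e / C" for D
    proof -
      have "(\<Sum>k\<in>D. \<bar>f (Sup k) - f (Inf k)\<bar>) \<le> (\<Sum>k\<in>D. C * (Sup k - Inf k))"
      proof (rule sum_mono)
        fix k assume "k \<in> D"
        then obtain u v where k: "k = {u..v}" "u \<le> v"
          using division_ofD(3,4)[OF D(1)] by (metis atLeastatMost_empty_iff box_real(2))
        moreover have "k \<subseteq> {a..b}" using D(2) \<open>k \<in> D\<close> by auto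
        ultimately show "\<bar>f (Sup k) - f (Inf k)\<bar> \<le> C * (Sup k - Inf k)"
          using lip[of u v] by auto
      qed
      also have "\<dots> < e"
        using less \<open>C > 0\<close> by (simp add: sum_distrib_left[symmetric] pos_less_divide_eq mult.commute)
      finally show ?thesis .
    qed
    then show "\<exists>d>0. \<forall>D. D division_of \<Union>D \<longrightarrow> \<Union>D \<subseteq> {a..b} \<longrightarrow>
        (\<Sum>k\<in>D. Sup k - Inf k) < d \<longrightarrow> (\<Sum>k\<in>D. \<bar>f (Sup k) - f (Inf k)\<bar>) < e"
      using \<open>e > 0\<close> \<open>C > 0\<close> by (intro exI[of _ "e / C"]) simp
  qed
  moreover have deriv_at: "(f has_real_derivative g t) (at t)" if "t \<in> {a<..<b}" for t
    using deriv[of t] that by (simp add: at_within_Icc_at)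
  moreover have "L2_on a b (deriv f)"
  proof -
    \<comment> \<open>At the endpoints \<open>deriv f\<close> depends on \<open>f\<close> outside
      the interval, so it may differ from \<open>g\<close> there; integrability is transferred
      across this null set.\<close>
    have neg: "negligible {a, b}" by simp
    have eq: "g t = deriv f t" if "t \<in> {a..b} - {a, b}" for t
      using DERIV_imp_deriv[OF deriv_at, of t] that by auto
    have "set_integrable lebesgue {a..b} g"
      using cont by (rule absolutely_integrable_continuous_real)
    then have "set_integrable lebesgue {a..b} (deriv f)"
      by (rule absolutely_integrable_spike[OF _ neg]) (simp add: eq)
    moreover have "set_integrable lebesgue {a..b} (\<lambda>t. (g t)\<^sup>2)"
      using cont by (intro absolutely_integrable_continuous_real continuous_intros)
    then have "set_integrable lebesgue {a..b} (\<lambda>t. (deriv f t)\<^sup>2)"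
      by (rule absolutely_integrable_spike[OF _ neg]) (simp add: eq)
    ultimately show ?thesis
      by (simp add: L2_on_def set_integrable_def set_borel_measurable_def borel_measurable_integrable)
  qed
  ultimately show ?thesis
    unfolding AC2_on_def field_differentiable_def by blast
qed

text \<open>All products below are integrable because \<open>deriv h\<close> is and its continuous
  factors are bounded. The Lebesgue integrals can therefore be compared as gauge integrals, the
  setting of \<open>H1_deriv_has_integral_0\<close>.\<close>

lemma form_eps_eq_0:
  assumes "a \<le> b"
    and w: "continuous_on {a..b} w"
    and deriv: "\<And>t. t \<in> {a..b} \<Longrightarrow> (f has_real_derivative w t * f t + k) (at t within {a..b})"
    and h: "h \<in> H1 a b"
  shows "form_eps a b w f h = 0"
proof -
  have f: "continuous_on {a..b} f"
    using deriv by (rule DERIV_continuous_on)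
  have h': "set_integrable lebesgue {a..b} (deriv h)"
    using h by (simp add: H1_def AC2_on_def L2_on_imp_set_integrable)
  have mult: "set_integrable lebesgue {a..b} (\<lambda>t. \<phi> t * deriv h t)" if "continuous_on {a..b} \<phi>" for \<phi>
    using that h'
    by (intro absolutely_integrable_bounded_measurable_product_real)
      (auto intro: continuous_imp_measurable_on_sets_lebesgue compact_imp_bounded compact_continuous_image)
  have wf: "set_integrable lebesgue {a..b} (\<lambda>t. (f t * w t) * deriv h t)"
    and wfk: "set_integrable lebesgue {a..b} (\<lambda>t. (w t * f t + k) * deriv h t)"
    using w f by (intro mult continuous_intros; simp)+
  \<comment> \<open>The common value of both integrals in the form: adding
    \<open>k * deriv h\<close> to the integrand leaves \<open>X\<close> unchanged, since its
    integral is 0.\<close>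
  define X where "X = integral {a..b} (\<lambda>t. (f t * w t) * deriv h t)"
  have "((\<lambda>t. (f t * w t) * deriv h t) has_integral X) {a..b}"
    unfolding X_def using set_lebesgue_integral_eq_integral(1)[OF wf] by (rule integrable_integral)
  from has_integral_add[OF this has_integral_mult_right[OF H1_deriv_has_integral_0[OF \<open>a \<le> b\<close> h], of k]]
  have X: "((\<lambda>t. (w t * f t + k) * deriv h t) has_integral X) {a..b}"
    by (simp add: algebra_simps)
  have eq: "deriv f t * deriv h t = (w t * f t + k) * deriv h t" if "t \<in> {a..b} - {a, b}" for t
  proof -
    have "deriv f t = w t * f t + k"
      using deriv[of t] that by (intro DERIV_imp_deriv) (auto simp: at_within_Icc_at)
    then show ?thesis by simp
  qed
  have neg: "negligible {a, b}" by simp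
  have "set_integrable lebesgue {a..b} (\<lambda>t. deriv f t * deriv h t)"
    using absolutely_integrable_spike[OF wfk neg eq] .
  then have "(LINT t:{a..b}|lebesgue. deriv f t * deriv h t) = integral {a..b} (\<lambda>t. deriv f t * deriv h t)"
    by (rule set_lebesgue_integral_eq_integral)
  also have "\<dots> = X"
    using has_integral_spike[OF neg eq X] by (rule integral_unique)
  also have "X = (LINT t:{a..b}|lebesgue. (f t * w t) * deriv h t)"
    unfolding X_def using set_lebesgue_integral_eq_integral(2)[OF wf] by simp
  finally show ?thesis
    by (simp add: form_eps_def mult_ac)
qed

subsection \<open>Integrals depending on a parameter\<close>

lemma LBINT_eq_integral:
  fixes g :: "real \<Rightarrow> real"
  assumes "continuous_on {c..d} g"
  shows "(LBINT s:{c..d}. g s) = integral {c..d} g"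
  using assms by (intro set_borel_integral_eq_integral(2) borel_integrable_atLeastAtMost')

lemma LBINT_upper_has_real_derivative:
  fixes g :: "real \<Rightarrow> real"
  assumes "continuous_on {a..b} g" "t \<in> {a..b}"
  shows "((\<lambda>t. LBINT s:{a..t}. g s) has_real_derivative g t) (at t within {a..b})"
  using integral_has_real_derivative[OF assms] zero_less_one assms(2)
proof (rule has_field_derivative_transform_within)
  fix x assume "x \<in> {a..b}"
  then show "integral {a..x} g = (LBINT s:{a..x}. g s)"
    using assms(1) by (subst LBINT_eq_integral) (auto elim: continuous_on_subset)
qed

lemma LBINT_lower_has_real_derivative:
  fixes g :: "real \<Rightarrow> real"
  assumes "continuous_on {a..b} g" "t \<in> {a..b}"
  shows "((\<lambda>t. LBINT s:{t..b}. g s) has_real_derivative - g t) (at t within {a..b})"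
  using integral_has_real_derivative'[OF assms] zero_less_one assms(2)
proof (rule has_field_derivative_transform_within)
  fix x assume "x \<in> {a..b}"
  then show "integral {x..b} g = (LBINT s:{x..b}. g s)"
    using assms(1) by (subst LBINT_eq_integral) (auto elim: continuous_on_subset)
qed

text \<open>Gives the parameter integrals their value 0 at the endpoint where the domain shrinks to
  a point.\<close>

lemma LBINT_singleton [simp]: "(LBINT s:{c}. g s) = (0 :: real)" for c :: real
  unfolding set_lebesgue_integral_def
  by (rule integral_eq_zero_AE, rule eventually_mono[OF AE_lborel_singleton[of c]]) simp

text \<open>By the mean value theorem for the integral as a function of its upper limit, the
  integral is \<open>g t * (b - a)\<close> for some \<open>t\<close>. This makes the denominators of
  both solutions positive.\<close>

lemma LBINT_pos:
  fixes g :: "real \<Rightarrow> real"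
  assumes "a < b" "continuous_on {a..b} g" "\<And>t. t \<in> {a..b} \<Longrightarrow> g t > 0"
  shows "(LBINT s:{a..b}. g s) > 0"
proof -
  have "\<exists>t\<in>{a..b}. (LBINT s:{a..b}. g s) - (LBINT s:{a..a}. g s) = g t * (b - a)"
    using assms LBINT_upper_has_real_derivative[OF assms(2)]
    by (intro mvt_very_simple) (auto simp: has_field_derivative_def)
  then show ?thesis using assms by auto
qed

text \<open>
  Rounding the time down to the grid \<open>\<int> / Suc n\<close> leaves countably many times, so the rounded process is
  jointly measurable; by continuity of the paths it converges to \<open>X\<close>.
\<close>

lemma borel_measurable_LBINT_continuous_paths:
  fixes X :: "real \<Rightarrow> 'a \<Rightarrow> real"
  assumes meas: "\<And>s. s \<in> {c..d} \<Longrightarrow> X s \<in> borel_measurable M"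
    and cont: "\<And>\<omega>. \<omega> \<in> space M \<Longrightarrow> continuous_on {c..d} (\<lambda>s. X s \<omega>)"
  shows "(\<lambda>\<omega>. LBINT s:{c..d}. X s \<omega>) \<in> borel_measurable M"
proof (cases "c \<le> d")
  case False
  then show ?thesis by (simp add: set_lebesgue_integral_def)
next
  case True
  \<comment> \<open>Freezing time at the endpoints extends the process to the whole line: grid
    points falling outside \<open>{c..d}\<close> become harmless, and the extended paths are
    continuous also at \<open>c\<close> and \<open>d\<close>. Inside the interval nothing
    changes.\<close>
  define clamp :: "real \<Rightarrow> real" where "clamp s = max c (min d s)" for s
  have clamp: "clamp s \<in> {c..d}" for s using True by (auto simp: clamp_def)
  have cont_clamp: "continuous_on UNIV clamp" unfolding clamp_def by (intro continuous_intros)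
  have "(\<lambda>(\<omega>, s :: real). X (clamp s) \<omega>) \<in> borel_measurable (M \<Otimes>\<^sub>M lborel)"
  proof (rule borel_measurable_LIMSEQ_real)
    fix n :: nat
    \<comment> \<open>For each fixed integer the inner function depends on the sample point alone;
      the measurable floor then selects among countably many such functions.\<close>
    have "(\<lambda>p :: 'a \<times> real. (\<lambda>(i :: int) p. X (clamp (i / Suc n)) (fst p)) \<lfloor>snd p * Suc n\<rfloor> p)
        \<in> borel_measurable (M \<Otimes>\<^sub>M lborel)"
    proof (rule measurable_compose_countable[where f = "\<lambda>(i :: int) p. X (clamp (i / Suc n)) (fst p)"])
      show "(\<lambda>p. X (clamp (real_of_int i / real (Suc n))) (fst p)) \<in> borel_measurable (M \<Otimes>\<^sub>M lborel)" for i
        using measurable_compose[OF measurable_fst meas[OF clamp]] .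
    qed measurable
    then show "(\<lambda>(\<omega>, s). X (clamp (\<lfloor>s * Suc n\<rfloor> / Suc n)) \<omega>) \<in> borel_measurable (M \<Otimes>\<^sub>M lborel)"
      by (simp add: split_def)
  next
    fix p :: "'a \<times> real" assume "p \<in> space (M \<Otimes>\<^sub>M lborel)"
    then obtain \<omega> s where p: "p = (\<omega>, s)" "\<omega> \<in> space M" by (auto simp: space_pair_measure)
    have "(\<lambda>n. \<lfloor>s * Suc n\<rfloor> / Suc n) \<longlonglongrightarrow> s"
    proof (rule tendsto_sandwich[of "\<lambda>n. s - 1 / Suc n" _ _ "\<lambda>n. s"])
      have "(\<lambda>n. s - 1 / real (Suc n)) \<longlonglongrightarrow> s - 0"
        by (intro tendsto_intros LIMSEQ_Suc lim_1_over_n)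
      then show "(\<lambda>n. s - 1 / real (Suc n)) \<longlonglongrightarrow> s" by simp
      have "s - 1 / Suc n \<le> \<lfloor>s * Suc n\<rfloor> / Suc n" for n
      proof -
        have "s - 1 / Suc n = (s * Suc n - 1) / Suc n"
          by (simp add: diff_divide_distrib del: of_nat_Suc)
        also have "\<dots> \<le> \<lfloor>s * Suc n\<rfloor> / Suc n"
          by (intro divide_right_mono) linarith+
        finally show ?thesis .
      qed
      then show "\<forall>\<^sub>F n in sequentially. s - 1 / Suc n \<le> \<lfloor>s * Suc n\<rfloor> / Suc n"
        by simp
      have "\<lfloor>s * Suc n\<rfloor> / Suc n \<le> s" for n
        by (simp add: pos_divide_le_eq del: of_nat_Suc)
      then show "\<forall>\<^sub>F n in sequentially. \<lfloor>s * Suc n\<rfloor> / Suc n \<le> s"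
        by simp
    qed simp
    moreover have "continuous_on UNIV (\<lambda>s. X (clamp s) \<omega>)"
      using clamp by (intro continuous_on_compose2[OF cont[OF p(2)] cont_clamp]) auto
    then have "isCont (\<lambda>s. X (clamp s) \<omega>) s" by (simp add: continuous_on_eq_continuous_at)
    ultimately have "(\<lambda>n. X (clamp (\<lfloor>s * Suc n\<rfloor> / Suc n)) \<omega>) \<longlonglongrightarrow> X (clamp s) \<omega>"
      by (rule isCont_tendsto_compose[rotated])
    then show "(\<lambda>n. case p of (\<omega>, s) \<Rightarrow> X (clamp (\<lfloor>s * Suc n\<rfloor> / Suc n)) \<omega>)
        \<longlonglongrightarrow> (case p of (\<omega>, s) \<Rightarrow> X (clamp s) \<omega>)"
      by (simp add: p)
  qed
  then have [measurable]: "(\<lambda>p. X (clamp (snd p)) (fst p)) \<in> borel_measurable (M \<Otimes>\<^sub>M lborel)"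
    by (simp add: split_def)
  have "(\<lambda>\<omega>. LBINT s:{c..d}. X (clamp s) \<omega>) \<in> borel_measurable M"
    unfolding set_lebesgue_integral_def
  proof (rule sigma_finite_measure.borel_measurable_lebesgue_integral[OF sigma_finite_lborel])
    have "(\<lambda>p. indicat_real {c..d} (snd p) *\<^sub>R X (clamp (snd p)) (fst p)) \<in> borel_measurable (M \<Otimes>\<^sub>M lborel)"
      by measurable
    then show "(\<lambda>(\<omega>, s :: real). indicat_real {c..d} s *\<^sub>R X (clamp s) \<omega>) \<in> borel_measurable (M \<Otimes>\<^sub>M lborel)"
      by (simp add: split_def)
  qed
  moreover have "(LBINT s:{c..d}. X (clamp s) \<omega>) = (LBINT s:{c..d}. X s \<omega>)" for \<omega>
    by (rule set_lebesgue_integral_cong) (auto simp: clamp_def)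
  ultimately show ?thesis by simp
qed

subsection \<open>The two solutions\<close>

theorem theorem4:
  fixes M :: "'a measure" and a b :: real and W :: "real \<Rightarrow> 'a \<Rightarrow> real"
  assumes "a < b"
    and "brownian_motion_on M a b W"
  shows "solution_L M a b W (sol_u a b W) \<and>
    solution_L M a b W (sol_v a b W) \<and>
    (\<forall>\<omega>\<in>space M. lin_indep_on {a..b} (\<lambda>t. sol_u a b W t \<omega>) (\<lambda>t. sol_v a b W t \<omega>)) \<and>
    (\<forall>\<omega>\<in>space M. sol_u a b W a \<omega> = 0 \<and> sol_u a b W b \<omega> = 1 \<and>
                 sol_v a b W a \<omega> = 1 \<and> sol_v a b W b \<omega> = 0)"
proof -
  have W_meas: "W t \<in> borel_measurable M" if "t \<in> {a..b}" for t
    using assms(2) that by (simp add: brownian_motion_on_def)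
  have W_cont: "continuous_on {a..b} (\<lambda>t. W t \<omega>)" if "\<omega> \<in> space M" for \<omega>
    using assms(2) that by (simp add: brownian_motion_on_def)
  define P where "P t \<omega> = (LBINT s:{a..t}. W s \<omega>)" for t \<omega>
  \<comment> \<open>The integrating factor of \<open>f' = W f\<close>. As
    \<open>exp P * G = 1\<close>, the products \<open>exp P * I\<close> and \<open>exp P * J\<close>
    solve the equation with right-hand constants 1 and -1; dividing by the normalizations scales
    these constants.\<close>
  define G where "G t \<omega> = exp (- P t \<omega>)" for t \<omega>
  define I where "I t \<omega> = (LBINT s:{a..t}. G s \<omega>)" for t \<omega>
  define J where "J t \<omega> = (LBINT s:{t..b}. G s \<omega>)" for t \<omega>
  have u: "sol_u a b W t \<omega> = exp (P t \<omega>) * I t \<omega> / (exp (P b \<omega>) * I b \<omega>)" for t \<omega>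
    by (simp add: sol_u_def P_def G_def I_def)
  have v: "sol_v a b W t \<omega> = exp (P t \<omega>) * J t \<omega> / I b \<omega>" for t \<omega>
    by (simp add: sol_v_def P_def G_def I_def J_def)
  have P_deriv: "((\<lambda>t. P t \<omega>) has_real_derivative W t \<omega>) (at t within {a..b})"
    if "\<omega> \<in> space M" "t \<in> {a..b}" for \<omega> t
    unfolding P_def using W_cont[OF that(1)] that(2) by (rule LBINT_upper_has_real_derivative)
  have G_cont: "continuous_on {a..b} (\<lambda>t. G t \<omega>)" if "\<omega> \<in> space M" for \<omega>
    unfolding G_def using DERIV_continuous_on[OF P_deriv[OF that]] by (intro continuous_intros)
  have I_deriv: "((\<lambda>t. I t \<omega>) has_real_derivative G t \<omega>) (at t within {a..b})"
    and J_deriv: "((\<lambda>t. J t \<omega>) has_real_derivative - G t \<omega>) (at t within {a..b})"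
    if "\<omega> \<in> space M" "t \<in> {a..b}" for \<omega> t
    unfolding I_def J_def using G_cont[OF that(1)] that(2)
    by (rule LBINT_upper_has_real_derivative LBINT_lower_has_real_derivative)+
  have I_pos: "I b \<omega> > 0" if "\<omega> \<in> space M" for \<omega>
    unfolding I_def using \<open>a < b\<close> G_cont[OF that] by (rule LBINT_pos) (simp add: G_def)
  have u_deriv: "((\<lambda>t. sol_u a b W t \<omega>) has_real_derivative
      W t \<omega> * sol_u a b W t \<omega> + 1 / (exp (P b \<omega>) * I b \<omega>)) (at t within {a..b})"
    if "\<omega> \<in> space M" "t \<in> {a..b}" for \<omega> t
    unfolding u
    by (rule derivative_eq_intros P_deriv[OF that] I_deriv[OF that] refl)+
      (use I_pos[OF that(1)] in \<open>simp_all add: G_def exp_minus field_simps\<close>)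
  \<comment> \<open>The negative constant is written as a summand to match
    \<open>+ k \<omega>\<close> in \<open>solution\<close>.\<close>
  have v_deriv: "((\<lambda>t. sol_v a b W t \<omega>) has_real_derivative
      W t \<omega> * sol_v a b W t \<omega> + - (1 / I b \<omega>)) (at t within {a..b})"
    if "\<omega> \<in> space M" "t \<in> {a..b}" for \<omega> t
    unfolding v
    by (rule derivative_eq_intros P_deriv[OF that] J_deriv[OF that] refl)+
      (use I_pos[OF that(1)] in \<open>simp_all add: G_def exp_minus field_simps\<close>)
  \<comment> \<open>The constant \<open>k\<close> may vary with the sample point but not with time.
    The form then vanishes on every path, which gives the almost sure statement for each test
    function.\<close>
  have solution: "solution_L M a b W f"
    if meas: "\<And>t. t \<in> {a..b} \<Longrightarrow> f t \<in> borel_measurable M"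
      and deriv: "\<And>\<omega> t. \<lbrakk>\<omega> \<in> space M; t \<in> {a..b}\<rbrakk> \<Longrightarrow>
        ((\<lambda>t. f t \<omega>) has_real_derivative W t \<omega> * f t \<omega> + k \<omega>) (at t within {a..b})" for f k
    unfolding solution_L_def
  proof (intro conjI ballI AE_I2)
    show "f t \<in> borel_measurable M" if "t \<in> {a..b}" for t using meas that .
    show "AC2_on a b (\<lambda>t. f t \<omega>)" if "\<omega> \<in> space M" for \<omega>
    proof (rule AC2_on_C1[OF deriv[OF that]])
      show "continuous_on {a..b} (\<lambda>t. W t \<omega> * f t \<omega> + k \<omega>)"
        using W_cont[OF that] DERIV_continuous_on[OF deriv[OF that]] by (intro continuous_intros)
    qed
    show "form_eps a b (\<lambda>t. W t \<omega>) (\<lambda>t. f t \<omega>) h = 0" if "h \<in> H1 a b" "\<omega> \<in> space M" for h \<omega>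
      using form_eps_eq_0[OF less_imp_le[OF \<open>a < b\<close>] W_cont[OF that(2)] deriv[OF that(2)] that(1)] .
  qed
  \<comment> \<open>Measurability is passed along the nested integrals: \<open>P\<close> from
    \<open>W\<close>, then \<open>G\<close>, then \<open>I\<close> and \<open>J\<close>, each time
    using continuity in time.\<close>
  have P_meas: "P t \<in> borel_measurable M" if "t \<in> {a..b}" for t
    unfolding P_def using that W_meas W_cont
    by (intro borel_measurable_LBINT_continuous_paths) (auto intro: continuous_on_subset[OF W_cont])
  have G_meas: "G t \<in> borel_measurable M" if "t \<in> {a..b}" for t
    unfolding G_def using P_meas[OF that] by measurable
  have I_meas: "I t \<in> borel_measurable M" and J_meas: "J t \<in> borel_measurable M" if "t \<in> {a..b}" for t
    unfolding I_def J_def using that G_meas G_cont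
    by (intro borel_measurable_LBINT_continuous_paths; auto intro: continuous_on_subset[OF G_cont])+
  have b: "b \<in> {a..b}" using \<open>a < b\<close> by simp
  have "solution_L M a b W (sol_u a b W)"
  proof (rule solution[OF _ u_deriv])
    show "sol_u a b W t \<in> borel_measurable M" if "t \<in> {a..b}" for t
      unfolding u[abs_def] using P_meas[OF that] P_meas[OF b] I_meas[OF that] I_meas[OF b] by measurable
  qed
  moreover have "solution_L M a b W (sol_v a b W)"
  proof (rule solution[OF _ v_deriv])
    show "sol_v a b W t \<in> borel_measurable M" if "t \<in> {a..b}" for t
      unfolding v[abs_def] using P_meas[OF that] J_meas[OF that] I_meas[OF b] by measurable
  qed
  moreover have boundary: "sol_u a b W a \<omega> = 0" "sol_u a b W b \<omega> = 1" "sol_v a b W a \<omega> = 1" "sol_v a b W b \<omega> = 0"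
    if "\<omega> \<in> space M" for \<omega>
  proof -
    \<comment> \<open>The first three are integrals over a single point; \<open>J a\<close> and
      \<open>I b\<close> are the same integral over the whole interval.\<close>
    have "P a \<omega> = 0" "I a \<omega> = 0" "J b \<omega> = 0" "J a \<omega> = I b \<omega>"
      by (simp_all add: P_def I_def J_def)
    then show "sol_u a b W a \<omega> = 0" "sol_u a b W b \<omega> = 1" "sol_v a b W a \<omega> = 1" "sol_v a b W b \<omega> = 0"
      using I_pos[OF that] by (simp_all add: u v)
  qed
  moreover have "lin_indep_on {a..b} (\<lambda>t. sol_u a b W t \<omega>) (\<lambda>t. sol_v a b W t \<omega>)" if "\<omega> \<in> space M" for \<omega>
    unfolding lin_indep_on_def
  proof (intro allI impI)
    fix c d assume comb: "\<forall>t\<in>{a..b}. c * sol_u a b W t \<omega> + d * sol_v a b W t \<omega> = 0"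
    show "c = 0 \<and> d = 0"
      \<comment> \<open>The boundary values form an identity matrix: time \<open>a\<close> isolates
        \<open>d\<close>, time \<open>b\<close> isolates \<open>c\<close>.\<close>
      using bspec[OF comb, of a] bspec[OF comb, of b] boundary[OF that] \<open>a < b\<close> by simp
  qed
  ultimately show ?thesis by blast
qed

end
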